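(* Let $\mathcal{J}$ be a complex $JB^*$-triple with norm $\|\cdot\|$ and triple product $\{xyz\}$. Let $f, h : \mathcal{J} \to \mathcal{J}$ be mappings with $f(0) = h(0) = 0$ for which there exists a function $\varphi : \mathcal{J}^3 \to [0,\infty)$ such that $$\sum_{j=0}^{\infty} 3^{3j}\,\varphi\left(\tfrac{x}{3^j}, \tfrac{y}{3^j}, \tfrac{z}{3^j}\right) < \infty,$$ $$\left\|2f\left(\tfrac{\mu x + y}{2}\right) - \mu f(x) - f(y)\right\| \le \varphi(x,y,0),$$ $$\left\|2h\left(\tfrac{\mu x + y}{2}\right) - \mu h(x) - h(y)\right\| \le \varphi(x,y,0),$$ $$\|f(\{xyz\}) - \{f(x)h(y)h(z)\} - \{h(x)f(y)h(z)\} - \{h(x)h(y)f(z)\}\| \le \varphi(x,y,z)$$ for all $x,y,z \in \mathcal{J}$ and all $\mu \in S^1 := \{\lambda \in \mathbb{C} : |\lambda| = 1\}$. Define $$\widetilde{\varphi}(x,y,z) := \sum_{j=0}^{\infty} 3^{j}\,\varphi\left(\tfrac{x}{3^j}, \tfrac{y}{3^j}, \tfrac{z}{3^j}\right)$$ for all $x,y,z\in\mathcal{J}$. Then there exist unique $\mathbb{C}$-linear mappings $D, \theta : \mathcal{J} \to \mathcal{J}$ such that $$\|f(x) - D(x)\| \le \widetilde{\varphi}\left(\tfrac{x}{3},-\tfrac{x}{3},0\right) + \widetilde{\varphi}\left(-\tfrac{x}{3},x,0\right),$$ $$\|h(x) - \theta(x)\| \le \widetilde{\varphi}\left(\tfrac{x}{3},-\tfrac{x}{3},0\right)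 + \widetilde{\varphi}\left(-\tfrac{x}{3},x,0\right)$$ for all $x \in \mathcal{J}$. Moreover, $D$ is a $\theta$-derivation on $\mathcal{J}$.
   Context: A (complex) $JB^*$-triple is a complex Banach space $\mathcal{J}$ with a continuous triple product $\{\cdot,\cdot,\cdot\} : \mathcal{J}\times\mathcal{J}\times\mathcal{J} \to \mathcal{J}$ (also written $\{xyz\} = \{x,y,z\}$), linear in the outer variables and conjugate linear in the middle variable, such that: (i) $\{x,y,z\} = \{z,y,x\}$; (ii) with $L(a,b)x := \{a,b,x\}$, $L(a,b)\{x,y,z\} = \{L(a,b)x,y,z\} - \{x,L(b,a)y,z\} + \{x,y,L(a,b)z\}$ for all $a,b,x,y,z\in\mathcal{J}$; (iii) for all $a \in \mathcal{J}$ the operator $L(a,a)$ is hermitian, i.e. $\|e^{itL(a,a)}\| = 1$ for all $t \in \mathbb{R}$, and has positive (i.e. contained in $[0,\infty)$) spectrum in the Banach algebra $B(\mathcal{J})$ of bounded linear operators on $\mathcal{J}$; (iv) $\|\{x,x,x\}\| = \|x\|^3$ for all $x \in \mathcal{J}$. Given a $\mathbb{C}$-linear mapping $\theta : \mathcal{J} \to \mathcal{J}$, a $\mathbb{C}$-linear mapping $D : \mathcal{J} \to \mathcal{J}$ is called a $\theta$-derivation on $\mathcal{J}$ if $D(\{xyz\}) = \{D(x)\theta(y)\theta(z)\} + \{\theta(x)D(y)\theta(z)\} + \{\theta(x)\theta(y)D(z)\}$ for all $x,y,z \in \mathcal{J}$. No continuity of $D$ or $\theta$ is assumed. *)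

theory Defs
  imports "HOL-Analysis.Analysis"
begin

(* Complex Banach spaces: a real Banach space together with a complex scalar multiplication
   that extends the real one and for which the norm is absolutely homogeneous. *)
class complex_banach = banach +
  fixes scaleC :: "complex \<Rightarrow> 'a \<Rightarrow> 'a" (infixr "*\<^sub>C" 75)
  assumes scaleC_add_right: "c *\<^sub>C (x + y) = c *\<^sub>C x + c *\<^sub>C y"
    and scaleC_add_left: "(c + d) *\<^sub>C x = c *\<^sub>C x + d *\<^sub>C x"
    and scaleC_scaleC: "c *\<^sub>C (d *\<^sub>C x) = (c * d) *\<^sub>C x"
    and scaleC_one: "1 *\<^sub>C x = x"
    and scaleC_of_real: "complex_of_real r *\<^sub>C x = r *\<^sub>R x"
    and norm_scaleC: "norm (c *\<^sub>C x) = cmod c * norm x"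

abbreviation clinear :: "('a::complex_banach \<Rightarrow> 'b::complex_banach) \<Rightarrow> bool" where
  "clinear \<equiv> Vector_Spaces.linear scaleC scaleC"

lemma vector_space_scaleC: "vector_space (scaleC :: complex \<Rightarrow> 'a::complex_banach \<Rightarrow> 'a)"
  by unfold_locales (simp_all add: scaleC_add_right scaleC_add_left scaleC_scaleC scaleC_one)

definition bounded_clinear :: "('a::complex_banach \<Rightarrow> 'a) \<Rightarrow> bool" where
  "bounded_clinear S \<longleftrightarrow> clinear S \<and> bounded_linear S"

(* The spectrum of T in the Banach algebra B('a): inverses are sought in B('a). *)
definition op_spectrum :: "('a::complex_banach \<Rightarrow> 'a) \<Rightarrow> complex set" where
  "op_spectrum T = {c. \<not> (\<exists>S. bounded_clinear S \<and>
     S \<circ> (\<lambda>x. T x - c *\<^sub>C x) = id \<and> (\<lambda>x. T x - c *\<^sub>C x) \<circ> S = id)}"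

(* The exponential series in B('a), evaluated pointwise; for bounded T the series converges
   in operator norm, hence pointwise to the same operator. *)
definition op_exp :: "('a::complex_banach \<Rightarrow> 'a) \<Rightarrow> 'a \<Rightarrow> 'a" where
  "op_exp T = (\<lambda>x. \<Sum>n. (T ^^ n) x /\<^sub>R fact n)"

definition hermitian_op :: "('a::complex_banach \<Rightarrow> 'a) \<Rightarrow> bool" where
  "hermitian_op T \<longleftrightarrow> (\<forall>t::real. onorm (op_exp (\<lambda>x. (\<i> * complex_of_real t) *\<^sub>C T x)) = 1)"

locale jb_star_triple =
  fixes triple :: "'a::complex_banach \<Rightarrow> 'a \<Rightarrow> 'a \<Rightarrow> 'a"
  assumes continuous: "continuous_on UNIV (\<lambda>(x, y, z). triple x y z)"
    and linear_left: "clinear (\<lambda>x. triple x y z)"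
    and linear_right: "clinear (\<lambda>z. triple x y z)"
    and middle_add: "triple x (y + y') z = triple x y z + triple x y' z"
    and middle_scaleC: "triple x (c *\<^sub>C y) z = cnj c *\<^sub>C triple x y z"
    and symmetric: "triple x y z = triple z y x"
    and jordan_identity: "triple a b (triple x y z) =
      triple (triple a b x) y z - triple x (triple b a y) z + triple x y (triple a b z)"
    and hermitian: "hermitian_op (triple a a)"
    and positive_spectrum: "op_spectrum (triple a a) \<subseteq> complex_of_real ` {0..}"
    and norm_cube: "norm (triple x x x) = norm x ^ 3"

definition theta_derivation ::
    "('a::complex_banach \<Rightarrow> 'a \<Rightarrow> 'a \<Rightarrow> 'a) \<Rightarrow> ('a \<Rightarrow> 'a) \<Rightarrow> ('a \<Rightarrow> 'a) \<Rightarrow> bool" where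
  "theta_derivation triple \<theta> D \<longleftrightarrow> clinear \<theta> \<and> clinear D \<and>
     (\<forall>x y z. D (triple x y z) =
        triple (D x) (\<theta> y) (\<theta> z) + triple (\<theta> x) (D y) (\<theta> z) + triple (\<theta> x) (\<theta> y) (D z))"

definition phi_tilde :: "('a::complex_banach \<Rightarrow> 'a \<Rightarrow> 'a \<Rightarrow> real) \<Rightarrow> 'a \<Rightarrow> 'a \<Rightarrow> 'a \<Rightarrow> real" where
  "phi_tilde \<phi> x y z = (\<Sum>j. 3 ^ j * \<phi> (x /\<^sub>R 3 ^ j) (y /\<^sub>R 3 ^ j) (z /\<^sub>R 3 ^ j))"

end

(* Hyers' direct method. The hypothesis with mu = 1 at (x, -x) and (-x, 3x) gives
   |f x - 3 f (x/3)| <= phi (x/3) (-x/3) 0 + phi (-x/3) x 0, so 3^j f (x/3^j) is a Cauchy sequence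
   whose limit D satisfies the stated bound. The error terms vanish in the limit, so D is additive and
   homogeneous for unimodular scalars, hence complex linear because every complex number is a natural
   multiple of a sum of two unimodular ones. Along 27^j the triple identity passes to the
   limit by joint continuity, and the bound at x/3^j, scaled by 3^j, is a tail of a convergent series,
   which forces uniqueness. *)

theory Submission
  imports Defs
begin

section \<open>Complex linearity tested on unimodular scalars\<close>

text \<open>Dividing \<open>c\<close> by a large enough \<open>n\<close> brings its modulus into
  [0, 2], where it equals \<open>2 * cos t\<close>, the sum of the conjugate points
  \<open>cis t\<close> and \<open>cis (- t)\<close>. Rotating both by \<open>Arg c\<close> restores
  the direction of \<open>c\<close>.\<close>

lemma sum_of_two_unimodular:
  fixes c :: complex
  obtains n :: nat and \<mu> \<nu> :: complex
  where "cmod \<mu> = 1" "cmod \<nu> = 1" "c = of_nat n * (\<mu> + \<nu>)"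
proof -
  obtain n :: nat where n: "cmod c < real n" using reals_Archimedean2 by blast
  then have n0: "real n > 0" using norm_ge_zero[of c] by linarith
  \<comment> \<open>The 2 in the denominator is the one in
    \<open>cis t + cis (- t) = 2 * cos t\<close>.\<close>
  define t where "t = arccos (cmod c / (2 * real n))"
  have "cmod c / (2 * real n) \<le> 1" using n n0 by (simp add: field_simps)
  moreover have "0 \<le> cmod c / (2 * real n)" using n0 by simp
  ultimately have "cos t = cmod c / (2 * real n)"
    unfolding t_def by (intro cos_arccos) linarith+
  then have "cmod c = real n * (2 * cos t)" using n0 by simp
  then have "complex_of_real (cmod c) = of_nat n * complex_of_real (2 * cos t)"
    by (metis of_real_mult of_real_of_nat_eq)
  moreover have "complex_of_real (2 * cos t) = cis t + cis (- t)"
    by (simp add: complex_eq_iff)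
  ultimately have "complex_of_real (cmod c) = of_nat n * (cis t + cis (- t))" by simp
  moreover have "c = complex_of_real (cmod c) * cis (Arg c)"
    by (metis rcis_cmod_Arg rcis_def)
  ultimately have "c = of_nat n * (cis (t + Arg c) + cis (- t + Arg c))"
    by (metis cis_mult distrib_right mult.assoc)
  then show thesis using that[of "cis (t + Arg c)" "cis (- t + Arg c)" n] by simp
qed

lemma scaleC_of_nat: "of_nat n *\<^sub>C (x::'a::complex_banach) = real n *\<^sub>R x"
  by (metis of_real_of_nat_eq scaleC_of_real)

lemma scaleC_scaleR: "c *\<^sub>C (r *\<^sub>R (x::'a::complex_banach)) = r *\<^sub>R (c *\<^sub>C x)"
  by (simp add: scaleC_of_real[symmetric] scaleC_scaleC mult.commute)

lemma clinear_scaleR: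
  assumes "clinear T"
  shows "T (r *\<^sub>R x) = r *\<^sub>R T x"
  using assms by (metis Vector_Spaces.linear_iff scaleC_of_real)

text \<open>Additivity is the case \<open>\<mu> = 1\<close>, and homogeneity for unimodular scalars
  the case \<open>y = 0\<close>. Additivity extends this to natural multiples of sums of two
  unimodular scalars, which exhaust the complex plane.\<close>

lemma clinear_if_unimodular_linear:
  fixes T :: "'a::complex_banach \<Rightarrow> 'b::complex_banach"
  assumes T: "\<And>\<mu> x y. cmod \<mu> = 1 \<Longrightarrow> T (\<mu> *\<^sub>C x + y) = \<mu> *\<^sub>C T x + T y"
  shows "clinear T"
proof -
  have add: "T (x + y) = T x + T y" for x y
    using T[of 1 x y] by (simp add: scaleC_one)
  have zero: "T 0 = 0" using add[of 0 0] by simp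
  have unimodular: "T (\<mu> *\<^sub>C x) = \<mu> *\<^sub>C T x" if "cmod \<mu> = 1" for \<mu> x
    using T[OF that, of x 0] zero by simp
  have nat: "T (real n *\<^sub>R x) = real n *\<^sub>R T x" for n x
    by (induction n) (simp_all add: zero add scaleR_add_left)
  have "T (c *\<^sub>C x) = c *\<^sub>C T x" for c x
  proof -
    obtain n \<mu> \<nu> where c: "cmod \<mu> = 1" "cmod \<nu> = 1" "c = of_nat n * (\<mu> + \<nu>)"
      by (rule sum_of_two_unimodular)
    then show ?thesis
      by (simp add: scaleC_scaleC[symmetric] scaleC_of_nat nat scaleC_add_left add unimodular)
  qed
  then show ?thesis
    using add by (simp add: Vector_Spaces.linear_iff vector_space_scaleC)
qed

section \<open>Hyers' direct method with scaling factor 3\<close>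

text \<open>The increments form an absolutely convergent series whose partial sums telescope to
  \<open>u 0 - u n\<close>. Its sum \<open>S\<close> is therefore \<open>u 0 - L\<close>, and the
  norm of \<open>S\<close> is controlled by the dominating series.\<close>

lemma convergent_if_summable_increments:
  fixes u :: "nat \<Rightarrow> 'a::banach"
  assumes step: "\<And>j. norm (u j - u (Suc j)) \<le> b j" and b: "summable b"
  obtains L where "u \<longlonglongrightarrow> L" "norm (u 0 - L) \<le> suminf b"
proof -
  have norms: "summable (\<lambda>j. norm (u j - u (Suc j)))"
    by (rule summable_comparison_test_ev[OF _ b]) (use step in simp)
  define S where "S = (\<Sum>j. u j - u (Suc j))"
  have "(\<lambda>n. \<Sum>j<n. u j - u (Suc j)) \<longlonglongrightarrow> S"
    unfolding S_def using summable_norm_cancel[OF norms] by (rule summable_LIMSEQ)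
  then have "(\<lambda>n. u 0 - u n) \<longlonglongrightarrow> S" by (simp add: sum_lessThan_telescope')
  from tendsto_diff[OF tendsto_const[of "u 0"] this] have "u \<longlonglongrightarrow> u 0 - S" by simp
  moreover have "norm S \<le> suminf b"
    unfolding S_def using summable_norm[OF norms] suminf_le[OF step norms b] by linarith
  ultimately show thesis using that by simp
qed

lemma hyers_direct_method:
  fixes f :: "'a::real_vector \<Rightarrow> 'b::banach" and \<psi> :: "'a \<Rightarrow> real"
  assumes step: "\<And>x. norm (f x - 3 *\<^sub>R f (x /\<^sub>R 3)) \<le> \<psi> x"
    and sm: "\<And>x. summable (\<lambda>j. 3 ^ j * \<psi> (x /\<^sub>R 3 ^ j))"
  obtains D where "\<And>x. (\<lambda>j. 3 ^ j *\<^sub>R f (x /\<^sub>R 3 ^ j)) \<longlonglongrightarrow> D x"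
    "\<And>x. norm (f x - D x) \<le> (\<Sum>j. 3 ^ j * \<psi> (x /\<^sub>R 3 ^ j))"
proof -
  have "\<exists>L. (\<lambda>j. 3 ^ j *\<^sub>R f (x /\<^sub>R 3 ^ j)) \<longlonglongrightarrow> L \<and>
      norm (f x - L) \<le> (\<Sum>j. 3 ^ j * \<psi> (x /\<^sub>R 3 ^ j))" for x
  proof -
    define u where "u j = 3 ^ j *\<^sub>R f (x /\<^sub>R 3 ^ j)" for j :: nat
    have "norm (u j - u (Suc j)) \<le> 3 ^ j * \<psi> (x /\<^sub>R 3 ^ j)" for j
    proof -
      \<comment> \<open>The increment is the defect in \<open>step\<close> at
        \<open>x /\<^sub>R 3 ^ j\<close>, magnified by \<open>3 ^ j\<close>; this is why
        \<open>sm\<close> carries the weight \<open>3 ^ j\<close>.\<close>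
      have "u j - u (Suc j) = 3 ^ j *\<^sub>R (f (x /\<^sub>R 3 ^ j) - 3 *\<^sub>R f ((x /\<^sub>R 3 ^ j) /\<^sub>R 3))"
        by (simp add: u_def scaleR_diff_right mult.commute)
      then show ?thesis using step[of "x /\<^sub>R 3 ^ j"] by simp
    qed
    then obtain L where "u \<longlonglongrightarrow> L" "norm (u 0 - L) \<le> (\<Sum>j. 3 ^ j * \<psi> (x /\<^sub>R 3 ^ j))"
      by (rule convergent_if_summable_increments[OF _ sm])
    then show ?thesis unfolding u_def by auto
  qed
  then have "\<exists>D. \<forall>x. (\<lambda>j. 3 ^ j *\<^sub>R f (x /\<^sub>R 3 ^ j)) \<longlonglongrightarrow> D x \<and>
      norm (f x - D x) \<le> (\<Sum>j. 3 ^ j * \<psi> (x /\<^sub>R 3 ^ j))"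
    by (intro choice allI)
  then show thesis using that by blast
qed

text \<open>Real homogeneity of \<open>T\<close> lets the bound at \<open>x /\<^sub>R 3 ^ n\<close>
  be multiplied by \<open>3 ^ n\<close>, which shifts the series to its tail from index
  \<open>n\<close>. Since the limit depends on \<open>f\<close> alone, any two such maps
  agree.\<close>

lemma hyers_limit_unique:
  fixes f :: "'a::complex_banach \<Rightarrow> 'b::complex_banach" and \<psi> :: "'a \<Rightarrow> real"
  assumes T: "clinear T"
    and bound: "\<And>x. norm (f x - T x) \<le> (\<Sum>j. 3 ^ j * \<psi> (x /\<^sub>R 3 ^ j))"
    and sm: "\<And>x. summable (\<lambda>j. 3 ^ j * \<psi> (x /\<^sub>R 3 ^ j))"
  shows "(\<lambda>j. 3 ^ j *\<^sub>R f (x /\<^sub>R 3 ^ j)) \<longlonglongrightarrow> T x"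
proof -
  define b where "b j = 3 ^ j * \<psi> (x /\<^sub>R 3 ^ j)" for j :: nat
  have b: "summable b" using sm by (simp add: b_def[abs_def])
  have "norm (3 ^ n *\<^sub>R f (x /\<^sub>R 3 ^ n) - T x) \<le> (\<Sum>j. b (j + n))" for n
  proof -
    have "T x = 3 ^ n *\<^sub>R T (x /\<^sub>R 3 ^ n)" by (simp add: clinear_scaleR[OF T])
    then have "norm (3 ^ n *\<^sub>R f (x /\<^sub>R 3 ^ n) - T x) = 3 ^ n * norm (f (x /\<^sub>R 3 ^ n) - T (x /\<^sub>R 3 ^ n))"
      by (metis abs_of_nonneg norm_scaleR scaleR_diff_right zero_le_numeral zero_le_power)
    also have "\<dots> \<le> 3 ^ n * (\<Sum>j. 3 ^ j * \<psi> ((x /\<^sub>R 3 ^ n) /\<^sub>R 3 ^ j))"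
      by (intro mult_left_mono bound) simp
    also have "\<dots> = (\<Sum>j. b (j + n))"
      unfolding b_def by (subst suminf_mult[OF sm, symmetric]) (simp add: power_add mult_ac)
    finally show ?thesis .
  qed
  moreover have "(\<lambda>n. \<Sum>j. b (j + n)) \<longlonglongrightarrow> 0" using b by (rule suminf_exist_split2)
  ultimately have "(\<lambda>n. 3 ^ n *\<^sub>R f (x /\<^sub>R 3 ^ n) - T x) \<longlonglongrightarrow> 0"
    by (rule Lim_null_comparison[OF always_eventually[OF allI]])
  then show ?thesis by (rule LIM_zero_cancel)
qed

section \<open>Stability of the Jensen functional equation\<close>

text \<open>Existence, bound and uniqueness are packaged for one map, so that the result serves both
  \<open>f\<close> and \<open>h\<close>. The limit formula is exported as well, since the derivation
  identity is obtained by passing to the limit.\<close>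

lemma jensen_stability:
  fixes f :: "'a::complex_banach \<Rightarrow> 'b::complex_banach" and \<phi> :: "'a \<Rightarrow> 'a \<Rightarrow> 'a \<Rightarrow> real"
  assumes f0: "f 0 = 0"
    and sm: "\<And>x y. summable (\<lambda>j. 3 ^ j * \<phi> (x /\<^sub>R 3 ^ j) (y /\<^sub>R 3 ^ j) 0)"
    and jensen: "\<And>(\<mu>::complex) x y. cmod \<mu> = 1 \<Longrightarrow>
      norm (2 *\<^sub>R f ((\<mu> *\<^sub>C x + y) /\<^sub>R 2) - \<mu> *\<^sub>C f x - f y) \<le> \<phi> x y 0"
  obtains D where "clinear D" "\<And>x. (\<lambda>j. 3 ^ j *\<^sub>R f (x /\<^sub>R 3 ^ j)) \<longlonglongrightarrow> D x"
    "\<And>x. norm (f x - D x) \<le> phi_tilde \<phi> (x /\<^sub>R 3) (- (x /\<^sub>R 3)) 0 + phi_tilde \<phi> (- (x /\<^sub>R 3)) x 0"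
    "\<And>T. clinear T \<Longrightarrow>
      (\<And>x. norm (f x - T x) \<le> phi_tilde \<phi> (x /\<^sub>R 3) (- (x /\<^sub>R 3)) 0 + phi_tilde \<phi> (- (x /\<^sub>R 3)) x 0)
      \<Longrightarrow> T = D"
proof -
  define \<psi> where "\<psi> x = \<phi> (x /\<^sub>R 3) (- (x /\<^sub>R 3)) 0 + \<phi> (- (x /\<^sub>R 3)) x 0" for x
  have swap: "(x /\<^sub>R 3 ^ j) /\<^sub>R 3 = (x /\<^sub>R 3) /\<^sub>R 3 ^ j" for x :: 'a and j :: nat
    by (simp add: mult.commute)
  have \<psi>_term: "3 ^ j * \<psi> (x /\<^sub>R 3 ^ j) =
      3 ^ j * \<phi> ((x /\<^sub>R 3) /\<^sub>R 3 ^ j) ((- (x /\<^sub>R 3)) /\<^sub>R 3 ^ j) 0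
      + 3 ^ j * \<phi> ((- (x /\<^sub>R 3)) /\<^sub>R 3 ^ j) (x /\<^sub>R 3 ^ j) 0" for x and j :: nat
    by (simp only: \<psi>_def swap distrib_left scaleR_minus_right)
  have \<psi>_sm: "summable (\<lambda>j. 3 ^ j * \<psi> (x /\<^sub>R 3 ^ j))" for x
    unfolding \<psi>_term by (intro summable_add sm)
  \<comment> \<open>This translates between the single error series of the direct method and the two
    \<open>phi_tilde\<close> values, for the bound and for uniqueness alike.\<close>
  have \<psi>_suminf: "(\<Sum>j. 3 ^ j * \<psi> (x /\<^sub>R 3 ^ j)) =
      phi_tilde \<phi> (x /\<^sub>R 3) (- (x /\<^sub>R 3)) 0 + phi_tilde \<phi> (- (x /\<^sub>R 3)) x 0" for x
    unfolding \<psi>_term phi_tilde_def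
    using suminf_add[OF sm[of "x /\<^sub>R 3" "- (x /\<^sub>R 3)"] sm[of "- (x /\<^sub>R 3)" x]] by simp
  have step: "norm (f x - 3 *\<^sub>R f (x /\<^sub>R 3)) \<le> \<psi> x" for x
  proof -
    define y where "y = x /\<^sub>R 3"
    have x: "x = 3 *\<^sub>R y" by (simp add: y_def)
    \<comment> \<open>The pair \<open>- y\<close>, \<open>3 *\<^sub>R y\<close> is chosen because
      its midpoint is \<open>y\<close>, so Jensen's inequality there relates \<open>f x\<close> to
      \<open>f y\<close> and \<open>f (- y)\<close>.\<close>
    have half: "(- y + 3 *\<^sub>R y) /\<^sub>R 2 = y"
    proof -
      have "- y + 3 *\<^sub>R y = 2 *\<^sub>R y" using scaleR_add_left[of "-1" 3 y] by simp
      then show ?thesis by (simp only: scaleR_scaleR) simp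
    qed
    \<comment> \<open>The midpoint of \<open>y\<close> and \<open>- y\<close> is 0, where
      \<open>f\<close> vanishes.\<close>
    have "norm (- f y - f (- y)) \<le> \<phi> y (- y) 0"
      using jensen[of 1 y "- y"] f0 by (simp add: scaleC_one)
    moreover have "norm (2 *\<^sub>R f y - f (- y) - f x) \<le> \<phi> (- y) x 0"
      using jensen[of 1 "- y" x] half by (simp add: scaleC_one x)
    \<comment> \<open>Subtraction cancels \<open>f (- y)\<close>; one copy of \<open>f y\<close>
      comes from the first defect and two from the second.\<close>
    moreover have "f x - 3 *\<^sub>R f y = (- f y - f (- y)) - (2 *\<^sub>R f y - f (- y) - f x)"
      using scaleR_add_left[of 1 2 "f y"] by simp
    ultimately have "norm (f x - 3 *\<^sub>R f y) \<le> \<phi> y (- y) 0 + \<phi> (- y) x 0"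
      using norm_triangle_le_diff[OF add_mono] by (simp only:)
    then show ?thesis unfolding \<psi>_def y_def .
  qed
  obtain D where lim: "\<And>x. (\<lambda>j. 3 ^ j *\<^sub>R f (x /\<^sub>R 3 ^ j)) \<longlonglongrightarrow> D x"
    and bound: "\<And>x. norm (f x - D x) \<le> (\<Sum>j. 3 ^ j * \<psi> (x /\<^sub>R 3 ^ j))"
    using hyers_direct_method[OF step \<psi>_sm] by blast
  have D_jensen: "2 *\<^sub>R D ((\<mu> *\<^sub>C x + y) /\<^sub>R 2) = \<mu> *\<^sub>C D x + D y" if "cmod \<mu> = 1" for \<mu> x y
  proof -
    let ?u = "\<lambda>x j. 3 ^ j *\<^sub>R f (x /\<^sub>R 3 ^ j)"
    let ?e = "\<lambda>j. 2 *\<^sub>R ?u ((\<mu> *\<^sub>C x + y) /\<^sub>R 2) j - \<mu> *\<^sub>C ?u x j - ?u y j"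
    have scaleC_lim: "(\<lambda>j. \<mu> *\<^sub>C ?u x j) \<longlonglongrightarrow> \<mu> *\<^sub>C D x"
    proof -
      have "bounded_linear (\<lambda>v. \<mu> *\<^sub>C (v::'b))"
        by (rule bounded_linear_intro[where K = "cmod \<mu>"])
          (simp_all add: scaleC_add_right scaleC_scaleR norm_scaleC mult.commute)
      then show ?thesis using lim by (rule bounded_linear.tendsto)
    qed
    \<comment> \<open>\<open>?e j\<close> is \<open>3 ^ j\<close> times the Jensen defect at the
      scaled points, hence bounded by a term of a summable series.\<close>
    have "norm (?e j) \<le> 3 ^ j * \<phi> (x /\<^sub>R 3 ^ j) (y /\<^sub>R 3 ^ j) 0" for j
    proof -
      let ?x = "x /\<^sub>R 3 ^ j" and ?y = "y /\<^sub>R 3 ^ j"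
      have "((\<mu> *\<^sub>C x + y) /\<^sub>R 2) /\<^sub>R 3 ^ j = (\<mu> *\<^sub>C ?x + ?y) /\<^sub>R 2"
        by (simp add: scaleC_scaleR scaleR_add_right mult.commute)
      then have "?e j = 3 ^ j *\<^sub>R (2 *\<^sub>R f ((\<mu> *\<^sub>C ?x + ?y) /\<^sub>R 2) - \<mu> *\<^sub>C f ?x - f ?y)"
        by (simp only: scaleC_scaleR scaleR_diff_right scaleR_left_commute)
      then show ?thesis using jensen[OF that, of ?x ?y] by simp
    qed
    then have "?e \<longlonglongrightarrow> 0"
      by (intro Lim_null_comparison[OF always_eventually summable_LIMSEQ_zero[OF sm[of x y]]] allI)
    moreover have "?e \<longlonglongrightarrow> 2 *\<^sub>R D ((\<mu> *\<^sub>C x + y) /\<^sub>R 2) - \<mu> *\<^sub>C D x - D y"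
      by (intro tendsto_diff tendsto_scaleR tendsto_const lim scaleC_lim)
    ultimately have "2 *\<^sub>R D ((\<mu> *\<^sub>C x + y) /\<^sub>R 2) - \<mu> *\<^sub>C D x - D y = 0"
      by (rule LIMSEQ_unique[symmetric])
    then show ?thesis by (simp add: algebra_simps)
  qed
  have D0: "D 0 = 0" using lim[of 0] f0 by (simp add: LIMSEQ_const_iff)
  \<comment> \<open>Taking \<open>y = 0\<close> absorbs the factors 2 and 1/2, turning Jensen's
    equation into additivity with a unimodular scalar.\<close>
  have halve: "2 *\<^sub>R D (x /\<^sub>R 2) = D x" for x
    using D_jensen[of 1 x 0] D0 by (simp add: scaleC_one)
  have lin: "clinear D"
    by (rule clinear_if_unimodular_linear) (metis D_jensen halve)
  show thesis
  proof (rule that[OF lin lim])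
    show "norm (f x - D x) \<le> phi_tilde \<phi> (x /\<^sub>R 3) (- (x /\<^sub>R 3)) 0 + phi_tilde \<phi> (- (x /\<^sub>R 3)) x 0" for x
      using bound[of x] by (simp only: \<psi>_suminf)
  next
    fix T
    assume "clinear T"
      and "\<And>x. norm (f x - T x) \<le> phi_tilde \<phi> (x /\<^sub>R 3) (- (x /\<^sub>R 3)) 0 + phi_tilde \<phi> (- (x /\<^sub>R 3)) x 0"
    then have "(\<lambda>j. 3 ^ j *\<^sub>R f (x /\<^sub>R 3 ^ j)) \<longlonglongrightarrow> T x" for x
      using hyers_limit_unique[of T f \<psi> x] \<psi>_sm by (simp only: \<psi>_suminf)
    then show "T = D" using lim LIMSEQ_unique by blast
  qed
qed

section \<open>Limits and scaling in the triple product\<close>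

context jb_star_triple
begin

text \<open>Conjugation fixes real scalars, so the conjugate linear middle slot behaves like the
  outer ones.\<close>

lemma triple_scaleR:
  "triple (a *\<^sub>R x) (b *\<^sub>R y) (c *\<^sub>R z) = (a * b * c) *\<^sub>R triple x y z"
proof -
  have "triple x (b *\<^sub>R y) z = b *\<^sub>R triple x y z" for x y z
    using middle_scaleC[of x "complex_of_real b" y z] by (simp add: scaleC_of_real)
  then show ?thesis
    by (simp add: clinear_scaleR[OF linear_left] clinear_scaleR[OF linear_right] mult_ac)
qed

lemma tendsto_triple:
  assumes "u \<longlonglongrightarrow> x" "v \<longlonglongrightarrow> y" "w \<longlonglongrightarrow> z"
  shows "(\<lambda>j. triple (u j) (v j) (w j)) \<longlonglongrightarrow> triple x y z"
  using continuous_on_tendsto_compose[OF continuous tendsto_Pair[OF assms(1) tendsto_Pair[OF assms(2,3)]]]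
  by simp

lemma theta_derivation_limit:
  assumes lin: "clinear D" "clinear \<theta>"
    and f: "\<And>x. (\<lambda>j. 3 ^ j *\<^sub>R f (x /\<^sub>R 3 ^ j)) \<longlonglongrightarrow> D x"
    and h: "\<And>x. (\<lambda>j. 3 ^ j *\<^sub>R h (x /\<^sub>R 3 ^ j)) \<longlonglongrightarrow> \<theta> x"
    and null: "\<And>x y z. (\<lambda>j. 3 ^ (3 * j) * \<phi> (x /\<^sub>R 3 ^ j) (y /\<^sub>R 3 ^ j) (z /\<^sub>R 3 ^ j)) \<longlonglongrightarrow> 0"
    and deriv: "\<And>x y z. norm (f (triple x y z) - triple (f x) (h y) (h z)
      - triple (h x) (f y) (h z) - triple (h x) (h y) (f z)) \<le> \<phi> x y z"
  shows "theta_derivation triple \<theta> D"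
proof -
  have "D (triple x y z) =
      triple (D x) (\<theta> y) (\<theta> z) + triple (\<theta> x) (D y) (\<theta> z) + triple (\<theta> x) (\<theta> y) (D z)" for x y z
  proof -
    let ?F = "\<lambda>x j. 3 ^ j *\<^sub>R f (x /\<^sub>R 3 ^ j)"
    let ?H = "\<lambda>x j. 3 ^ j *\<^sub>R h (x /\<^sub>R 3 ^ j)"
    \<comment> \<open>Scaling each argument by \<open>3 ^ j\<close> scales the triple product by
      \<open>3 ^ (3 * j)\<close>. So \<open>f\<close> at the product is followed along the
      subsequence \<open>3 * j\<close>, while every slot of the other terms uses index
      \<open>j\<close>.\<close>
    let ?e = "\<lambda>j. ?F (triple x y z) (3 * j) - triple (?F x j) (?H y j) (?H z j)
      - triple (?H x j) (?F y j) (?H z j) - triple (?H x j) (?H y j) (?F z j)"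
    have cube: "(3::real) ^ j * 3 ^ j * 3 ^ j = 3 ^ (3 * j)" for j :: nat
      by (simp flip: power_add)
    have "norm (?e j) \<le> 3 ^ (3 * j) * \<phi> (x /\<^sub>R 3 ^ j) (y /\<^sub>R 3 ^ j) (z /\<^sub>R 3 ^ j)" for j
    proof -
      let ?x = "x /\<^sub>R 3 ^ j" and ?y = "y /\<^sub>R 3 ^ j" and ?z = "z /\<^sub>R 3 ^ j"
      have "triple x y z /\<^sub>R 3 ^ (3 * j) = triple ?x ?y ?z"
        by (simp only: triple_scaleR cube[symmetric] inverse_mult_distrib)
      then have "?e j = 3 ^ (3 * j) *\<^sub>R (f (triple ?x ?y ?z) - triple (f ?x) (h ?y) (h ?z)
          - triple (h ?x) (f ?y) (h ?z) - triple (h ?x) (h ?y) (f ?z))"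
        by (simp only: triple_scaleR cube scaleR_diff_right)
      then show ?thesis using deriv[of ?x ?y ?z] by simp
    qed
    then have "?e \<longlonglongrightarrow> 0"
      by (intro Lim_null_comparison[OF always_eventually null[of x y z]] allI)
    moreover have "(\<lambda>j. ?F (triple x y z) (3 * j)) \<longlonglongrightarrow> D (triple x y z)"
      using LIMSEQ_subseq_LIMSEQ[OF f[of "triple x y z"], of "\<lambda>j. 3 * j"]
      by (simp add: strict_mono_def comp_def)
    then have "?e \<longlonglongrightarrow> D (triple x y z) - triple (D x) (\<theta> y) (\<theta> z)
        - triple (\<theta> x) (D y) (\<theta> z) - triple (\<theta> x) (\<theta> y) (D z)"
      by (intro tendsto_diff tendsto_triple f h)
    ultimately have "D (triple x y z) - triple (D x) (\<theta> y) (\<theta> z)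
        - triple (\<theta> x) (D y) (\<theta> z) - triple (\<theta> x) (\<theta> y) (D z) = 0"
      by (rule LIMSEQ_unique[symmetric])
    then show ?thesis by (simp add: algebra_simps)
  qed
  then show ?thesis using lin unfolding theta_derivation_def by blast
qed

end

section \<open>Stability of approximate \<theta>-derivations\<close>

theorem theorem2p5:
  fixes triple :: "'a::complex_banach \<Rightarrow> 'a \<Rightarrow> 'a \<Rightarrow> 'a"
    and f h :: "'a \<Rightarrow> 'a"
    and \<phi> :: "'a \<Rightarrow> 'a \<Rightarrow> 'a \<Rightarrow> real"
  assumes "jb_star_triple triple"
    and "f 0 = 0" and "h 0 = 0"
    and "\<And>x y z. 0 \<le> \<phi> x y z"
    and "\<And>x y z. summable (\<lambda>j. 3 ^ (3 * j) * \<phi> (x /\<^sub>R 3 ^ j) (y /\<^sub>R 3 ^ j) (z /\<^sub>R 3 ^ j))"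
    and "\<And>(\<mu>::complex) x y. cmod \<mu> = 1 \<Longrightarrow>
      norm (2 *\<^sub>R f ((\<mu> *\<^sub>C x + y) /\<^sub>R 2) - \<mu> *\<^sub>C f x - f y) \<le> \<phi> x y 0"
    and "\<And>(\<mu>::complex) x y. cmod \<mu> = 1 \<Longrightarrow>
      norm (2 *\<^sub>R h ((\<mu> *\<^sub>C x + y) /\<^sub>R 2) - \<mu> *\<^sub>C h x - h y) \<le> \<phi> x y 0"
    and "\<And>x y z. norm (f (triple x y z) - triple (f x) (h y) (h z)
      - triple (h x) (f y) (h z) - triple (h x) (h y) (f z)) \<le> \<phi> x y z"
  shows "\<exists>D \<theta>.
    (clinear D \<and> clinear \<theta> \<and>
     (\<forall>x. norm (f x - D x) \<le> phi_tilde \<phi> (x /\<^sub>R 3) (- (x /\<^sub>R 3)) 0 + phi_tilde \<phi> (- (x /\<^sub>R 3)) x 0) \<and>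
     (\<forall>x. norm (h x - \<theta> x) \<le> phi_tilde \<phi> (x /\<^sub>R 3) (- (x /\<^sub>R 3)) 0 + phi_tilde \<phi> (- (x /\<^sub>R 3)) x 0)) \<and>
    (\<forall>D'. clinear D' \<and>
       (\<forall>x. norm (f x - D' x) \<le> phi_tilde \<phi> (x /\<^sub>R 3) (- (x /\<^sub>R 3)) 0 + phi_tilde \<phi> (- (x /\<^sub>R 3)) x 0)
       \<longrightarrow> D' = D) \<and>
    (\<forall>\<theta>'. clinear \<theta>' \<and>
       (\<forall>x. norm (h x - \<theta>' x) \<le> phi_tilde \<phi> (x /\<^sub>R 3) (- (x /\<^sub>R 3)) 0 + phi_tilde \<phi> (- (x /\<^sub>R 3)) x 0)
       \<longrightarrow> \<theta>' = \<theta>) \<and>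
    theta_derivation triple \<theta> D"
proof -
  \<comment> \<open>The hypothesis has weight \<open>3 ^ (3 * j)\<close>, which dominates the weight
    \<open>3 ^ j\<close> of \<open>phi_tilde\<close>; the third argument 0 is unchanged by
    scaling.\<close>
  have sm: "summable (\<lambda>j. 3 ^ j * \<phi> (x /\<^sub>R 3 ^ j) (y /\<^sub>R 3 ^ j) 0)" for x y
  proof (rule summable_comparison_test'[OF assms(5)[of x y 0], of 0])
    fix j :: nat
    have "(3::real) ^ j \<le> 3 ^ (3 * j)" by (intro power_increasing) auto
    then show "norm (3 ^ j * \<phi> (x /\<^sub>R 3 ^ j) (y /\<^sub>R 3 ^ j) 0)
        \<le> 3 ^ (3 * j) * \<phi> (x /\<^sub>R 3 ^ j) (y /\<^sub>R 3 ^ j) (0 /\<^sub>R 3 ^ j)"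
      using assms(4) by (simp add: mult_right_mono)
  qed
  obtain D where D: "clinear D" "\<And>x. (\<lambda>j. 3 ^ j *\<^sub>R f (x /\<^sub>R 3 ^ j)) \<longlonglongrightarrow> D x"
    "\<And>x. norm (f x - D x) \<le> phi_tilde \<phi> (x /\<^sub>R 3) (- (x /\<^sub>R 3)) 0 + phi_tilde \<phi> (- (x /\<^sub>R 3)) x 0"
    "\<And>T. clinear T \<Longrightarrow>
      (\<And>x. norm (f x - T x) \<le> phi_tilde \<phi> (x /\<^sub>R 3) (- (x /\<^sub>R 3)) 0 + phi_tilde \<phi> (- (x /\<^sub>R 3)) x 0)
      \<Longrightarrow> T = D"
    using jensen_stability[of f \<phi>, OF assms(2) sm assms(6)] by blast
  obtain \<theta> where \<theta>: "clinear \<theta>" "\<And>x. (\<lambda>j. 3 ^ j *\<^sub>R h (x /\<^sub>R 3 ^ j)) \<longlonglongrightarrow> \<theta> x"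
    "\<And>x. norm (h x - \<theta> x) \<le> phi_tilde \<phi> (x /\<^sub>R 3) (- (x /\<^sub>R 3)) 0 + phi_tilde \<phi> (- (x /\<^sub>R 3)) x 0"
    "\<And>T. clinear T \<Longrightarrow>
      (\<And>x. norm (h x - T x) \<le> phi_tilde \<phi> (x /\<^sub>R 3) (- (x /\<^sub>R 3)) 0 + phi_tilde \<phi> (- (x /\<^sub>R 3)) x 0)
      \<Longrightarrow> T = \<theta>"
    using jensen_stability[of h \<phi>, OF assms(3) sm assms(7)] by blast
  \<comment> \<open>Here the full weight \<open>3 ^ (3 * j)\<close> is used: summability makes the
    magnified errors of the triple identity tend to 0.\<close>
  have "theta_derivation triple \<theta> D"
    using jb_star_triple.theta_derivation_limit[OF assms(1) D(1) \<theta>(1) D(2) \<theta>(2)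
        summable_LIMSEQ_zero[OF assms(5)] assms(8)] .
  then show ?thesis
    by (intro exI[of _ D] exI[of _ \<theta>] conjI allI impI) (blast intro: D \<theta>)+
qed

end
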